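(* Let $$u(x)=\sum_{i=1}^\infty u_i\sin(ix),\qquad v(x)=\sum_{i=1}^\infty v_i\sin(ix)$$ with real coefficients, and assume that for some integer $n\ge 1$, some $s>1$ and some constants $C_u>0$, $C_v>0$, $$u_i\in\frac{C_u[-1,1]}{i^s}\quad\text{and}\quad v_i\in\frac{C_v[-1,1]}{i^s}\qquad\text{for } i>n.$$ Then $$(uv)(x)=(uv)_0+\sum_{k=1}^\infty (uv)_k\cos(kx),$$ with $$(uv)_0=\frac12\sum_{i=1}^\infty u_iv_i,\qquad (uv)_k=\frac12\sum_{i=1}^\infty u_{i+k}v_i+\frac12\sum_{i=1}^\infty u_iv_{i+k}-\frac12\sum_{i=1}^{k-1}u_iv_{k-i}\quad (k\ge1),$$ and the following estimates hold. For $k=0$, $$(uv)_0\in\frac12\sum_{i=1}^n u_iv_i+\frac{C_uC_v}{2}\,\frac{n^{1-2s}}{2s-1}[-1,1].$$ For $1\le k\le 2n$, $$(uv)_k\in\frac12\sum_{i=1}^n u_iv_{i+k}+\frac12\sum_{i=1}^n u_{i+k}v_i-\frac12\sum_{i=1}^{k-1}u_iv_{k-i}+C_uC_v\frac{n^{1-2s}}{2s-1}[-1,1].$$ For $k>2n$, $$(uv)_k\in\frac{D[-1,1]}{k^s},\qquad D=\frac12\left(\sum_{i=1}^n\big(C_u|v_i|+C_v|u_i|\big)\left(1+\left(\frac{2n+1}{2n+1-i}\right)^s\right)+C_uC_v(2+2^s)\frac{n^{1-s}}{s-1}\right).$$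
   Context: For real numbers $a,c$, the notation $a+c[-1,1]$ denotes the interval $\{a+c\theta:\theta\in[-1,1]\}$, and $\frac{C[-1,1]}{i^s}$ denotes $\left[-\frac{C}{i^s},\frac{C}{i^s}\right]$. *)

theory Defs
  imports Complex_Main
begin

text \<open>
  Coefficient sequences are functions on \<^typ>\<open>nat\<close> whose value at \<open>0\<close> is never used;
  a series over \<open>i \<ge> 1\<close> is a \<^const>\<open>suminf\<close> with the index shifted by \<^const>\<open>Suc\<close>.
\<close>

definition centered_interval :: "real \<Rightarrow> real \<Rightarrow> real set" where
  "centered_interval a c = {a + c * \<theta> | \<theta>. \<theta> \<in> {-1..1}}"

definition sine_series :: "(nat \<Rightarrow> real) \<Rightarrow> real \<Rightarrow> real" where
  "sine_series u x = (\<Sum>i. u (Suc i) * sin (real (Suc i) * x))"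

definition prod_coeff :: "(nat \<Rightarrow> real) \<Rightarrow> (nat \<Rightarrow> real) \<Rightarrow> nat \<Rightarrow> real" where
  "prod_coeff u v k =
     (if k = 0 then 1 / 2 * (\<Sum>i. u (Suc i) * v (Suc i))
      else 1 / 2 * (\<Sum>i. u (Suc i + k) * v (Suc i))
         + 1 / 2 * (\<Sum>i. u (Suc i) * v (Suc i + k))
         - 1 / 2 * (\<Sum>i = 1..k - 1. u i * v (k - i)))"

definition tail_bound ::
  "(nat \<Rightarrow> real) \<Rightarrow> (nat \<Rightarrow> real) \<Rightarrow> real \<Rightarrow> real \<Rightarrow> real \<Rightarrow> nat \<Rightarrow> real" where
  "tail_bound u v Cu Cv s n =
     1 / 2 * ((\<Sum>i = 1..n. (Cu * \<bar>v i\<bar> + Cv * \<bar>u i\<bar>)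
                  * (1 + ((2 * real n + 1) / (2 * real n + 1 - real i)) powr s))
              + Cu * Cv * (2 + 2 powr s) * (real n powr (1 - s) / (s - 1)))"

end

theory Submission
  imports Defs "HOL-Analysis.Infinite_Sum" "HOL-Analysis.Convex" "HOL-Analysis.Elementary_Metric_Spaces"
begin

text \<open>
  Both sine series converge absolutely, so their product is a sum over pairs \<open>(i, j)\<close>, and
  \<open>2 sin(ix) sin(jx) = cos((i - j)x) - cos((i + j)x)\<close>. Collecting the first cosine along the
  diagonals \<open>i - j = \<plusminus>k\<close> gives the two correlation sums of the coefficient of \<open>cos(kx)\<close>, and
  collecting the second along \<open>i + j = k\<close> gives the convolution sum.

  All tails are controlled by \<open>\<Sum>\<^sub>i\<^sub>>\<^sub>n i\<^sup>-\<^sup>p \<le> n\<^sup>1\<^sup>-\<^sup>p / (p - 1)\<close>. In the convolution sum for \<open>k > 2n\<close> the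
  \<open>n\<close> terms at each end have one factor in the decaying range at index \<open>k - i\<close>, and
  \<open>k / (k - i) \<le> (2n + 1) / (2n + 1 - i)\<close>. In the middle range both factors decay, and convexity gives
  \<open>(k / (i (k - i)))\<^sup>s = (1/i + 1/(k - i))\<^sup>s \<le> 2\<^sup>s\<^sup>-\<^sup>1 (i\<^sup>-\<^sup>s + (k - i)\<^sup>-\<^sup>s)\<close>.
\<close>

section \<open>Tails of inverse power sums and a convexity inequality\<close>

text \<open>Discrete form of the integral comparison. By the mean value theorem the difference on
  the right, divided by \<open>p - 1\<close>, equals \<open>z powr (- p)\<close> for some
  \<open>z < Suc n\<close>, and this power decreases in \<open>z\<close>. The right side telescopes
  when summed over \<open>n\<close>.\<close>

lemma powr_le_telescope:
  fixes p :: real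
  assumes "p > 1" "n \<ge> 1"
  shows "1 / real (Suc n) powr p \<le> (real n powr (1 - p) - real (Suc n) powr (1 - p)) / (p - 1)"
proof -
  have "\<exists>z. real n < z \<and> z < real (Suc n) \<and>
      real (Suc n) powr (1 - p) - real n powr (1 - p) = (real (Suc n) - real n) * ((1 - p) * z powr (- p))"
  proof (rule MVT2)
    fix x assume "real n \<le> x" "x \<le> real (Suc n)"
    then show "((\<lambda>x. x powr (1 - p)) has_real_derivative (1 - p) * x powr (- p)) (at x)"
      using has_real_derivative_powr[of x "1 - p"] assms by simp
  qed simp
  then obtain z where z: "real n < z" "z < real (Suc n)"
    and eq: "real n powr (1 - p) - real (Suc n) powr (1 - p) = (p - 1) * z powr (- p)"
    by (auto simp: algebra_simps)
  have "1 / real (Suc n) powr p = real (Suc n) powr (- p)"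
    by (simp add: powr_minus_divide)
  also have "\<dots> \<le> z powr (- p)"
    using z assms by (intro powr_mono2') auto
  finally show ?thesis
    unfolding eq using assms by simp
qed

lemma sum_powr_tail_le:
  fixes p :: real
  assumes "p > 1" "n \<ge> 1"
  shows "(\<Sum>i<m. 1 / real (Suc (i + n)) powr p) \<le> real n powr (1 - p) / (p - 1)"
proof -
  \<comment> \<open>The subtracted end term lets the induction telescope; it is dropped only
    afterwards.\<close>
  have "(\<Sum>i<m. 1 / real (Suc (i + n)) powr p)
      \<le> (real n powr (1 - p) - real (m + n) powr (1 - p)) / (p - 1)"
  proof (induction m)
    case (Suc m)
    then show ?case
      using powr_le_telescope[of p "m + n"] assms by (simp add: diff_divide_distrib)
  qed simp
  also have "\<dots> \<le> real n powr (1 - p) / (p - 1)"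
    using assms by (intro divide_right_mono) auto
  finally show ?thesis .
qed

text \<open>One uniform bound on the partial sums beyond \<open>n\<close> yields both summability
  and the truncation error. The first \<open>n\<close> terms are arbitrary, hence the comparison
  with the head sum instead of with zero. It is applied with \<open>p = s\<close> and with
  \<open>p = 2 * s\<close>.\<close>

lemma powr_decay_tail:
  fixes f :: "nat \<Rightarrow> real" and p C :: real
  assumes "p > 1" "n \<ge> 1" "C \<ge> 0"
    and bound: "\<And>i. i > n \<Longrightarrow> \<bar>f i\<bar> \<le> C * (1 / real i powr p)"
  shows "summable (\<lambda>i. \<bar>f (Suc i)\<bar>)"
    and "\<bar>(\<Sum>i. f (Suc i)) - (\<Sum>i = 1..n. f i)\<bar> \<le> C * (real n powr (1 - p) / (p - 1))"
proof -
  let ?R = "C * (real n powr (1 - p) / (p - 1))"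
  have partial: "(\<Sum>i<m. \<bar>f (Suc (i + n))\<bar>) \<le> ?R" for m
  proof -
    have "(\<Sum>i<m. \<bar>f (Suc (i + n))\<bar>) \<le> C * (\<Sum>i<m. 1 / real (Suc (i + n)) powr p)"
      unfolding sum_distrib_left by (intro sum_mono bound) simp
    also have "\<dots> \<le> ?R"
      using assms by (intro mult_left_mono sum_powr_tail_le)
    finally show ?thesis .
  qed
  have tail: "summable (\<lambda>i. \<bar>f (Suc (i + n))\<bar>)"
    by (rule summableI_nonneg_bounded[where x = ?R]) (use partial in auto)
  show sm: "summable (\<lambda>i. \<bar>f (Suc i)\<bar>)"
    using tail by (subst summable_iff_shift[of _ n, symmetric]) simp
  have "(\<Sum>i = 1..n. f i) = (\<Sum>i<n. f (Suc i))"
    by (simp add: sum.atLeast1_atMost_eq)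
  then have "(\<Sum>i. f (Suc i)) - (\<Sum>i = 1..n. f i) = (\<Sum>i. f (Suc (i + n)))"
    using suminf_split_initial_segment[OF summable_rabs_cancel[OF sm], of n] by simp
  also have "\<bar>\<dots>\<bar> \<le> (\<Sum>i. \<bar>f (Suc (i + n))\<bar>)"
    using tail by (rule summable_rabs)
  also have "\<dots> \<le> ?R"
    using tail partial by (intro suminf_le_const)
  finally show "\<bar>(\<Sum>i. f (Suc i)) - (\<Sum>i = 1..n. f i)\<bar> \<le> ?R" .
qed

text \<open>Convexity of \<open>t powr s\<close> at the midpoint of \<open>x\<close> and
  \<open>y\<close>, multiplied through by \<open>2 powr s\<close>.\<close>

lemma powr_sum_le:
  fixes x y s :: real
  assumes "s \<ge> 1" "x > 0" "y > 0"
  shows "(x + y) powr s \<le> 2 powr (s - 1) * (x powr s + y powr s)"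
proof -
  have "((1 - 1 / 2) *\<^sub>R x + (1 / 2) *\<^sub>R y) powr s \<le> (1 - 1 / 2) * x powr s + (1 / 2) * y powr s"
    using assms by (intro convex_onD[OF powr_convex]) auto
  then have "2 powr s * ((x + y) / 2) powr s \<le> 2 powr s * ((x powr s + y powr s) / 2)"
    by (intro mult_left_mono) (auto simp: field_simps)
  moreover have "2 powr s * ((x + y) / 2) powr s = (x + y) powr s"
    using assms by (subst powr_mult[symmetric]) (auto intro!: arg_cong2[where f = "(powr)"])
  ultimately show ?thesis
    by (simp add: powr_diff)
qed

section \<open>Unconditional summation over index pairs and its rearrangements\<close>

text \<open>The family is dominated by \<open>\<bar>a i\<bar> * \<bar>b j\<bar>\<close>, whose
  double sum factors. The bounded weight \<open>w\<close> stands for the trigonometric factors, and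
  the free set \<open>A\<close> gives summability on every diagonal or triangle used below.\<close>

lemma product_weighted_summable_on:
  fixes a b :: "nat \<Rightarrow> real" and w :: "nat \<Rightarrow> nat \<Rightarrow> real"
  assumes "summable (\<lambda>i. \<bar>a i\<bar>)" "summable (\<lambda>i. \<bar>b i\<bar>)" "\<And>i j. \<bar>w i j\<bar> \<le> 1"
  shows "(\<lambda>(i, j). a i * b j * w i j) summable_on A"
proof -
  have "(\<lambda>(i, j). \<bar>a i\<bar> * \<bar>b j\<bar>) summable_on UNIV \<times> UNIV"
  proof (rule summable_on_SigmaI)
    show "((\<lambda>j. case (i, j) of (i, j) \<Rightarrow> \<bar>a i\<bar> * \<bar>b j\<bar>) has_sum \<bar>a i\<bar> * (\<Sum>\<^sub>\<infinity>j. \<bar>b j\<bar>)) UNIV" for i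
      using assms(2) by (auto intro!: has_sum_cmult_right has_sum_infsum norm_summable_imp_summable_on)
    show "(\<lambda>i. \<bar>a i\<bar> * (\<Sum>\<^sub>\<infinity>j. \<bar>b j\<bar>)) summable_on UNIV"
      using assms(1) by (intro summable_on_cmult_left norm_summable_imp_summable_on) simp
  qed auto
  then have "(\<lambda>(i, j). \<bar>a i\<bar> * \<bar>b j\<bar>) summable_on UNIV"
    by simp
  then have "(\<lambda>(i, j). a i * b j * w i j) abs_summable_on UNIV"
  proof (rule abs_summable_on_comparison_test')
    fix ij :: "nat \<times> nat"
    show "norm (case ij of (i, j) \<Rightarrow> a i * b j * w i j) \<le> (case ij of (i, j) \<Rightarrow> \<bar>a i\<bar> * \<bar>b j\<bar>)"
      using assms(3) by (auto simp: abs_mult mult_left_le split: prod.splits)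
  qed
  then show ?thesis
    using abs_summable_summable summable_on_subset_banach by blast
qed


text \<open>The terms form the subfamily of all products lying on the diagonal of pairs
  \<open>(j + k, j)\<close>. The value is written as an ordinary series to agree with
  \<open>prod_coeff\<close>.\<close>

lemma shifted_product_has_sum:
  fixes a b :: "nat \<Rightarrow> real"
  assumes "summable (\<lambda>i. \<bar>a i\<bar>)" "summable (\<lambda>i. \<bar>b i\<bar>)"
  shows "((\<lambda>j. a (j + k) * b j) has_sum (\<Sum>j. a (j + k) * b j)) UNIV"
proof -
  have "(\<lambda>(i, j). a i * b j * 1) summable_on range (\<lambda>j. (j + k, j))"
    using assms by (intro product_weighted_summable_on) auto
  then have "(\<lambda>j. a (j + k) * b j) summable_on UNIV"
    by (subst (asm) summable_on_reindex) (auto simp: inj_on_def o_def)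
  then have "((\<lambda>j. a (j + k) * b j) has_sum (\<Sum>\<^sub>\<infinity>j. a (j + k) * b j)) UNIV"
    by (rule has_sum_infsum)
  then show ?thesis
    by (simp only: sums_unique[OF has_sum_imp_sums, symmetric])
qed

text \<open>The triangle \<open>j < i\<close> is cut into diagonals \<open>i - j = Suc k\<close>.
  The weight is constant on each of them, so it factors out of the inner sum.\<close>

lemma off_diagonal_has_sum:
  fixes a b c :: "nat \<Rightarrow> real"
  assumes "summable (\<lambda>i. \<bar>a i\<bar>)" "summable (\<lambda>i. \<bar>b i\<bar>)" "\<And>k. \<bar>c k\<bar> \<le> 1"
  shows "((\<lambda>k. (\<Sum>j. a (j + Suc k) * b j) * c (Suc k)) has_sum
      (\<Sum>\<^sub>\<infinity>(i, j)\<in>{(i, j). j < i}. a i * b j * c (i - j))) UNIV"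
proof -
  let ?F = "\<lambda>(i, j). a i * b j * c (i - j)"
  have "?F summable_on {(i, j). j < i}"
    using assms by (intro product_weighted_summable_on)
  then have "(?F has_sum infsum ?F {(i, j). j < i}) {(i, j). j < i}"
    by (rule has_sum_infsum)
  also have "?this \<longleftrightarrow> ((\<lambda>(k, j). a (j + Suc k) * b j * c (Suc k)) has_sum infsum ?F {(i, j). j < i}) (UNIV \<times> UNIV)"
    by (rule has_sum_reindex_bij_witness[where i = "\<lambda>(k, j). (j + Suc k, j)" and j = "\<lambda>(i, j). (i - Suc j, j)"])
       (auto simp: Suc_diff_Suc)
  finally show ?thesis
    by (rule has_sum_Sigma')
       (simp only: prod.case, intro has_sum_cmult_left shifted_product_has_sum assms)
qed

text \<open>Indices are zero-based: the pair \<open>(i, j)\<close> carries the frequencies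
  \<open>Suc i\<close> and \<open>Suc j\<close>, with total \<open>Suc (Suc (i + j))\<close>.
  Frequency \<open>Suc k\<close> therefore collects the pairs with \<open>Suc (i + j) = k\<close>,
  and there are none for \<open>k = 0\<close>.\<close>

lemma antidiagonal_has_sum:
  fixes a b c :: "nat \<Rightarrow> real"
  assumes "summable (\<lambda>i. \<bar>a i\<bar>)" "summable (\<lambda>i. \<bar>b i\<bar>)" "\<And>k. \<bar>c k\<bar> \<le> 1"
  shows "((\<lambda>k. (\<Sum>i<k. a i * b (k - Suc i)) * c (Suc k)) has_sum
      (\<Sum>\<^sub>\<infinity>(i, j). a i * b j * c (Suc (Suc (i + j))))) UNIV"
proof -
  let ?F = "\<lambda>(i, j). a i * b j * c (Suc (Suc (i + j)))"
  have "?F summable_on UNIV"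
    using assms by (intro product_weighted_summable_on)
  then have "(?F has_sum infsum ?F UNIV) UNIV"
    by (rule has_sum_infsum)
  also have "?this \<longleftrightarrow> ((\<lambda>(k, i). a i * b (k - Suc i) * c (Suc k)) has_sum infsum ?F UNIV) (SIGMA k:UNIV. {..<k})"
    by (rule has_sum_reindex_bij_witness[where i = "\<lambda>(k, i). (i, k - Suc i)" and j = "\<lambda>(i, j). (Suc (i + j), i)"])
       auto
  finally show ?thesis
    by (rule has_sum_Sigma') (simp add: sum_distrib_right has_sum_finite)
qed

text \<open>With truncated subtraction, \<open>i - j + (j - i)\<close> is the distance of
  \<open>i\<close> and \<open>j\<close>. The upper triangle is reflected onto the lower one, which
  exchanges \<open>a\<close> and \<open>b\<close>, so \<open>off_diagonal_has_sum\<close> handles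
  both.\<close>

lemma product_infsum_split:
  fixes a b c :: "nat \<Rightarrow> real"
  assumes "summable (\<lambda>i. \<bar>a i\<bar>)" "summable (\<lambda>i. \<bar>b i\<bar>)" "\<And>k. \<bar>c k\<bar> \<le> 1"
  shows "(\<Sum>\<^sub>\<infinity>(i, j). a i * b j * c (i - j + (j - i))) = (\<Sum>i. a i * b i) * c 0
     + (\<Sum>\<^sub>\<infinity>(i, j)\<in>{(i, j). j < i}. a i * b j * c (i - j))
     + (\<Sum>\<^sub>\<infinity>(i, j)\<in>{(i, j). j < i}. b i * a j * c (i - j))"
proof -
  let ?F = "\<lambda>(i, j). a i * b j * c (i - j + (j - i))"
  have F: "?F summable_on A" for A
    using assms by (intro product_weighted_summable_on)
  have "((\<lambda>i. a i * b i) has_sum (\<Sum>i. a i * b i)) UNIV"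
    using shifted_product_has_sum[of a b 0] assms by simp
  then have "((\<lambda>i. a i * b i * c 0) has_sum (\<Sum>i. a i * b i) * c 0) UNIV"
    by (rule has_sum_cmult_left)
  also have "?this \<longleftrightarrow> (?F has_sum (\<Sum>i. a i * b i) * c 0) {(i, j). i = j}"
    by (rule has_sum_reindex_bij_witness[where i = fst and j = "\<lambda>i. (i, i)"]) auto
  finally have diag: "infsum ?F {(i, j). i = j} = (\<Sum>i. a i * b i) * c 0"
    by (rule infsumI)
  have lower: "infsum ?F {(i, j). j < i} = (\<Sum>\<^sub>\<infinity>(i, j)\<in>{(i, j). j < i}. a i * b j * c (i - j))"
    by (rule infsum_cong) auto
  have upper: "infsum ?F {(i, j). i < j} = (\<Sum>\<^sub>\<infinity>(i, j)\<in>{(i, j). j < i}. b i * a j * c (i - j))"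
    by (rule infsum_reindex_bij_witness[where i = prod.swap and j = prod.swap]) auto
  have "infsum ?F UNIV = infsum ?F ({(i, j). i = j} \<union> {(i, j). j < i} \<union> {(i, j). i < j})"
    by (rule arg_cong[where f = "infsum ?F"]) auto
  also have "\<dots> = infsum ?F ({(i, j). i = j} \<union> {(i, j). j < i}) + infsum ?F {(i, j). i < j}"
    by (intro infsum_Un_disjoint F) auto
  also have "infsum ?F ({(i, j). i = j} \<union> {(i, j). j < i}) = infsum ?F {(i, j). i = j} + infsum ?F {(i, j). j < i}"
    by (intro infsum_Un_disjoint F) auto
  finally show ?thesis
    by (simp only: diag lower upper)
qed

section \<open>The cosine series of a product of two sine series\<close>

lemma abs_summable_sine_series:
  fixes f :: "nat \<Rightarrow> real"
  assumes "summable (\<lambda>i. \<bar>f (Suc i)\<bar>)"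
  shows "summable (\<lambda>i. \<bar>f (Suc i) * sin (real (Suc i) * x)\<bar>)"
  by (rule summable_comparison_test'[where N = 0, OF assms]) (simp add: abs_mult mult_left_le)

lemma sine_series_product:
  assumes u: "summable (\<lambda>i. \<bar>u (Suc i)\<bar>)" and v: "summable (\<lambda>i. \<bar>v (Suc i)\<bar>)"
  shows "(\<lambda>k. prod_coeff u v (Suc k) * cos (real (Suc k) * x))
    sums (sine_series u x * sine_series v x - prod_coeff u v 0)"
proof -
  define a where "a i = u (Suc i)" for i
  define b where "b i = v (Suc i)" for i
  define c where "c k = cos (real k * x)" for k :: nat
  have a: "summable (\<lambda>i. \<bar>a i\<bar>)" and b: "summable (\<lambda>i. \<bar>b i\<bar>)" and c: "\<bar>c k\<bar> \<le> 1" for k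
    using u v by (simp_all add: a_def b_def c_def)
  let ?S = "\<lambda>i. sin (real (Suc i) * x)"
  have series_has_sum: "((\<lambda>i. f (Suc i) * ?S i) has_sum sine_series f x) UNIV"
    if "summable (\<lambda>i. \<bar>f (Suc i)\<bar>)" for f
    using abs_summable_sine_series[OF that, of x] unfolding sine_series_def
    by (intro norm_summable_imp_has_sum summable_sums[OF summable_rabs_cancel]) simp_all
  let ?P = "\<lambda>(i, j). a i * b j * (?S i * ?S j)"
  let ?D = "\<lambda>(i, j). a i * b j * c (i - j + (j - i))"
  let ?A = "\<lambda>(i, j). a i * b j * c (Suc (Suc (i + j)))"
  have "(?P has_sum sine_series u x * sine_series v x) (UNIV \<times> UNIV)"
  proof (rule has_sum_SigmaI)
    show "((\<lambda>j. ?P (i, j)) has_sum a i * ?S i * sine_series v x) UNIV" for i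
      using has_sum_cmult_right[OF series_has_sum[OF v], of "a i * ?S i"]
      by (simp add: b_def mult_ac)
    show "((\<lambda>i. a i * ?S i * sine_series v x) has_sum sine_series u x * sine_series v x) UNIV"
      using has_sum_cmult_left[OF series_has_sum[OF u], of "sine_series v x"]
      by (simp add: a_def)
    show "?P summable_on UNIV \<times> UNIV"
      by (intro product_weighted_summable_on a b)
         (simp add: abs_mult mult_le_one)
  qed
  \<comment> \<open>The product-to-sum formula, pointwise in \<open>(i, j)\<close>; evenness of the
    cosine covers the case \<open>i < j\<close>.\<close>
  moreover have "?P = (\<lambda>p. 1 / 2 * (?D p - ?A p))"
  proof (intro ext, clarify)
    fix i j :: nat
    have "c (i - j + (j - i)) = cos (real (Suc i) * x - real (Suc j) * x)"
    proof (cases "j \<le> i")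
      case True
      then show ?thesis by (simp add: c_def of_nat_diff algebra_simps)
    next
      case False
      then have "c (i - j + (j - i)) = cos (- (real (Suc i) * x - real (Suc j) * x))"
        by (simp add: c_def of_nat_diff algebra_simps)
      then show ?thesis by (simp only: cos_minus)
    qed
    moreover have "c (Suc (Suc (i + j))) = cos (real (Suc i) * x + real (Suc j) * x)"
      by (simp add: c_def algebra_simps)
    ultimately show "a i * b j * (?S i * ?S j)
        = 1 / 2 * (a i * b j * c (i - j + (j - i)) - a i * b j * c (Suc (Suc (i + j))))"
      by (simp add: sin_times_sin right_diff_distrib)
  qed
  moreover have "?D summable_on UNIV" "?A summable_on UNIV"
    by (intro product_weighted_summable_on a b c)+
  then have "((\<lambda>p. 1 / 2 * (?D p - ?A p)) has_sum 1 / 2 * (infsum ?D UNIV - infsum ?A UNIV)) UNIV"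
    unfolding diff_conv_add_uminus
    by (intro has_sum_cmult_right has_sum_add has_sum_uminusI has_sum_infsum)
  ultimately have product: "sine_series u x * sine_series v x = 1 / 2 * (infsum ?D UNIV - infsum ?A UNIV)"
    using has_sum_unique by fastforce
  let ?L = "\<Sum>\<^sub>\<infinity>(i, j)\<in>{(i, j). j < i}. a i * b j * c (i - j)"
  let ?U = "\<Sum>\<^sub>\<infinity>(i, j)\<in>{(i, j). j < i}. b i * a j * c (i - j)"
  have "((\<lambda>k. 1 / 2 * ((\<Sum>j. a (j + Suc k) * b j) * c (Suc k))
            + 1 / 2 * ((\<Sum>j. b (j + Suc k) * a j) * c (Suc k))
            - 1 / 2 * ((\<Sum>i<k. a i * b (k - Suc i)) * c (Suc k)))
         has_sum (1 / 2 * ?L + 1 / 2 * ?U - 1 / 2 * infsum ?A UNIV)) UNIV"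
    unfolding diff_conv_add_uminus
    by (intro has_sum_add has_sum_uminusI has_sum_cmult_right off_diagonal_has_sum antidiagonal_has_sum a b c)
  moreover have "1 / 2 * ((\<Sum>j. a (j + Suc k) * b j) * c (Suc k))
            + 1 / 2 * ((\<Sum>j. b (j + Suc k) * a j) * c (Suc k))
            - 1 / 2 * ((\<Sum>i<k. a i * b (k - Suc i)) * c (Suc k))
          = prod_coeff u v (Suc k) * cos (real (Suc k) * x)" for k
  proof -
    \<comment> \<open>The convolution sum of the coefficient with index \<open>Suc k\<close> runs
      over \<open>1..k\<close>; it is shifted here to the zero-based sequences.\<close>
    have "(\<Sum>i = 1..k. u i * v (Suc k - i)) = (\<Sum>i<k. a i * b (k - Suc i))"
      unfolding One_nat_def sum.atLeast1_atMost_eq a_def b_def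
      by (rule sum.cong) (auto simp: Suc_diff_Suc)
    then show ?thesis
      by (simp add: prod_coeff_def a_def b_def c_def algebra_simps)
  qed
  \<comment> \<open>What \<open>?L\<close>, \<open>?U\<close> and \<open>?A\<close> leave over is
    the main diagonal, which carries \<open>c 0 = 1\<close> and gives the constant
    coefficient.\<close>
  moreover have "1 / 2 * ?L + 1 / 2 * ?U - 1 / 2 * infsum ?A UNIV
      = sine_series u x * sine_series v x - prod_coeff u v 0"
    unfolding product product_infsum_split[of a b c, OF a b c]
    by (simp add: prod_coeff_def a_def b_def c_def algebra_simps)
  ultimately show ?thesis
    by (intro has_sum_imp_sums) simp
qed


section \<open>Enclosures and decay of the coefficients\<close>

text \<open>The parameter is \<open>(z - a) / c\<close>. For \<open>c = 0\<close> the assumption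
  forces \<open>z = a\<close>, and the parameter \<open>0\<close> serves.\<close>

lemma mem_centered_interval:
  assumes "\<bar>z - a\<bar> \<le> c"
  shows "z \<in> centered_interval a c"
proof (cases "c = 0")
  case True
  with assms show ?thesis by (auto simp: centered_interval_def intro: exI[of _ 0])
next
  case False
  with assms have "c > 0" by linarith
  with assms have "z = a + c * ((z - a) / c)" "(z - a) / c \<in> {-1..1}"
    by (auto simp: field_simps abs_le_iff)
  then show ?thesis unfolding centered_interval_def by blast
qed

lemma abs_mult_decay_le:
  fixes C D x y :: real
  assumes "\<bar>x\<bar> \<le> C * p" "\<bar>y\<bar> \<le> D * q" "C \<ge> 0" "D \<ge> 0" "p * q \<le> r"
  shows "\<bar>x * y\<bar> \<le> C * D * r"
proof -
  have "\<bar>x * y\<bar> \<le> (C * p) * (D * q)"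
    \<comment> \<open>\<open>C * p\<close> is nonnegative because it bounds an absolute
      value.\<close>
    unfolding abs_mult using assms by (intro mult_mono) (auto intro: order_trans[OF abs_ge_zero])
  also have "\<dots> = C * D * (p * q)" by simp
  also have "\<dots> \<le> C * D * r" using assms by (intro mult_left_mono) auto
  finally show ?thesis .
qed

text \<open>Beyond \<open>n\<close> both factors decay. Discarding the shift in the first one leaves
  exponent \<open>2 * s\<close>. The shift \<open>k = 0\<close> is included and serves the constant
  coefficient.\<close>

lemma shifted_product_tail:
  fixes u v :: "nat \<Rightarrow> real" and s Cu Cv :: real
  assumes "n \<ge> 1" "s > 1" "Cu \<ge> 0" "Cv \<ge> 0"
    and u: "\<And>i. i > n \<Longrightarrow> \<bar>u i\<bar> \<le> Cu * (1 / real i powr s)"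
    and v: "\<And>i. i > n \<Longrightarrow> \<bar>v i\<bar> \<le> Cv * (1 / real i powr s)"
  shows "\<bar>(\<Sum>i. u (Suc i + k) * v (Suc i)) - (\<Sum>i = 1..n. u (i + k) * v i)\<bar>
    \<le> Cu * Cv * (real n powr (1 - 2 * s) / (2 * s - 1))"
proof (rule powr_decay_tail(2)[where f = "\<lambda>i. u (i + k) * v i"])
  fix i assume i: "i > n"
  have "1 / real (i + k) powr s * (1 / real i powr s) \<le> 1 / real i powr s * (1 / real i powr s)"
    using assms i by (intro mult_right_mono divide_left_mono powr_mono2) auto
  also have "\<dots> = 1 / real i powr (2 * s)"
    by (simp add: powr_add[symmetric])
  finally show "\<bar>u (i + k) * v i\<bar> \<le> Cu * Cv * (1 / real i powr (2 * s))"
    by (intro abs_mult_decay_le[OF u v]) (use i assms(3,4) in auto)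
qed (use assms in auto)

text \<open>Since \<open>k > n\<close>, the factor \<open>u (i + k)\<close> is in its decaying range
  for every \<open>i\<close> and supplies \<open>1 / real k powr s\<close>. The other factor is
  summed as it stands up to \<open>n\<close> and by its decay beyond.\<close>

lemma shifted_product_decay:
  fixes u v :: "nat \<Rightarrow> real" and s Cu Cv :: real
  assumes "n \<ge> 1" "s > 1" "Cu \<ge> 0" "Cv \<ge> 0" "k > n"
    and u: "\<And>i. i > n \<Longrightarrow> \<bar>u i\<bar> \<le> Cu * (1 / real i powr s)"
    and v: "\<And>i. i > n \<Longrightarrow> \<bar>v i\<bar> \<le> Cv * (1 / real i powr s)"
  shows "\<bar>\<Sum>i. u (Suc i + k) * v (Suc i)\<bar>
    \<le> ((\<Sum>i = 1..n. Cu * \<bar>v i\<bar>) + Cu * Cv * (real n powr (1 - s) / (s - 1))) * (1 / real k powr s)"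
proof -
  have le: "1 / real (i + k) powr s \<le> 1 / real k powr s" for i
    using assms by (intro divide_left_mono powr_mono2) auto
  have "\<bar>(\<Sum>i. u (Suc i + k) * v (Suc i)) - (\<Sum>i = 1..n. u (i + k) * v i)\<bar>
      \<le> Cu * Cv * (1 / real k powr s) * (real n powr (1 - s) / (s - 1))"
  proof (rule powr_decay_tail(2)[where f = "\<lambda>i. u (i + k) * v i"])
    fix i assume i: "i > n"
    have "1 / real (i + k) powr s * (1 / real i powr s) \<le> 1 / real k powr s * (1 / real i powr s)"
      by (intro mult_right_mono le) auto
    then have "\<bar>u (i + k) * v i\<bar> \<le> Cu * Cv * (1 / real k powr s * (1 / real i powr s))"
      by (intro abs_mult_decay_le[OF u v]) (use i assms(3,4) in auto)
    then show "\<bar>u (i + k) * v i\<bar> \<le> Cu * Cv * (1 / real k powr s) * (1 / real i powr s)"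
      by (simp only: mult.assoc)
  qed (use assms in auto)
  moreover have "\<bar>\<Sum>i = 1..n. u (i + k) * v i\<bar> \<le> (\<Sum>i = 1..n. Cu * \<bar>v i\<bar> * (1 / real k powr s))"
  proof (rule order_trans[OF sum_abs], rule sum_mono)
    fix i
    have "\<bar>u (i + k)\<bar> \<le> Cu * (1 / real (i + k) powr s)"
      by (rule u) (use assms in simp)
    also have "\<dots> \<le> Cu * (1 / real k powr s)"
      using assms by (intro mult_left_mono le)
    finally have "\<bar>u (i + k)\<bar> * \<bar>v i\<bar> \<le> Cu * (1 / real k powr s) * \<bar>v i\<bar>"
      by (rule mult_right_mono) simp
    then show "\<bar>u (i + k) * v i\<bar> \<le> Cu * \<bar>v i\<bar> * (1 / real k powr s)"
      by (simp add: abs_mult mult_ac)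
  qed
  ultimately have "\<bar>\<Sum>i. u (Suc i + k) * v (Suc i)\<bar>
      \<le> (\<Sum>i = 1..n. Cu * \<bar>v i\<bar> * (1 / real k powr s))
        + Cu * Cv * (1 / real k powr s) * (real n powr (1 - s) / (s - 1))"
    by linarith
  also have "\<dots> = ((\<Sum>i = 1..n. Cu * \<bar>v i\<bar>) + Cu * Cv * (real n powr (1 - s) / (s - 1))) * (1 / real k powr s)"
    unfolding distrib_right sum_distrib_right by (simp only: mult_ac)
  finally show ?thesis .
qed

text \<open>The range is cut after \<open>n\<close> and before \<open>k - n\<close>;
  \<open>k > 2 * n\<close> keeps the two end blocks disjoint. The ends give the weighted finite sum,
  the middle block gives the \<open>2 powr s\<close> term.\<close>

lemma convolution_decay:
  fixes u v :: "nat \<Rightarrow> real" and s Cu Cv :: real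
  assumes "n \<ge> 1" "s > 1" "Cu \<ge> 0" "Cv \<ge> 0" and k: "k > 2 * n"
    and u: "\<And>i. i > n \<Longrightarrow> \<bar>u i\<bar> \<le> Cu * (1 / real i powr s)"
    and v: "\<And>i. i > n \<Longrightarrow> \<bar>v i\<bar> \<le> Cv * (1 / real i powr s)"
  shows "\<bar>\<Sum>i = 1..k - 1. u i * v (k - i)\<bar>
    \<le> ((\<Sum>i = 1..n. (Cu * \<bar>v i\<bar> + Cv * \<bar>u i\<bar>) * ((2 * real n + 1) / (2 * real n + 1 - real i)) powr s)
        + Cu * Cv * 2 powr s * (real n powr (1 - s) / (s - 1))) * (1 / real k powr s)"
proof -
  let ?q = "\<lambda>i. ((2 * real n + 1) / (2 * real n + 1 - real i)) powr s"
  let ?K = "1 / real k powr s"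
  let ?R = "real n powr (1 - s) / (s - 1)"
  have shift: "1 / real (k - i) powr s \<le> ?q i * ?K" if "i \<le> n" for i
  proof -
    \<comment> \<open>For fixed \<open>i\<close> the ratio \<open>k / (k - i)\<close> does not
      increase with \<open>k\<close>, so its value at the smallest admissible \<open>k\<close>,
      namely \<open>2 * n + 1\<close>, is the bound. This inequality is the cross-multiplied
      form.\<close>
    have "real i * (2 * real n + 1) \<le> real i * real k"
      using k by (intro mult_left_mono) auto
    then have "real k / real (k - i) \<le> (2 * real n + 1) / (2 * real n + 1 - real i)"
      using that k by (simp add: divide_simps of_nat_diff) (simp add: algebra_simps)
    then have "(real k / real (k - i)) powr s \<le> ?q i"
      using assms by (intro powr_mono2) auto
    then show ?thesis
      using k that by (simp add: powr_divide field_simps)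
  qed
  \<comment> \<open>Stated for a generic \<open>f\<close> and \<open>C\<close>, to be used at both
    ends with \<open>u\<close> and \<open>v\<close> exchanged.\<close>
  have edge: "\<bar>x * f (k - i)\<bar> \<le> C * \<bar>x\<bar> * ?q i * ?K"
    if "i \<le> n" "C \<ge> 0" "\<And>i. i > n \<Longrightarrow> \<bar>f i\<bar> \<le> C * (1 / real i powr s)" for x C f i
  proof -
    have "\<bar>f (k - i)\<bar> \<le> C * (1 / real (k - i) powr s)"
      by (rule that(3)) (use that(1) k in simp)
    also have "\<dots> \<le> C * (?q i * ?K)"
      using that by (intro mult_left_mono shift)
    finally have "\<bar>x\<bar> * \<bar>f (k - i)\<bar> \<le> \<bar>x\<bar> * (C * (?q i * ?K))"
      by (rule mult_left_mono) simp
    then show ?thesis by (simp add: abs_mult mult_ac)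
  qed
  have middle: "\<bar>u i * v (k - i)\<bar> \<le> Cu * Cv * (2 powr (s - 1) * (1 / real i powr s + 1 / real (k - i) powr s) * ?K)"
    if "i \<in> {n + 1..k - n - 1}" for i
  proof (rule abs_mult_decay_le)
    have i: "i > n" "k - i > n" "i < k" using that k by auto
    show "\<bar>u i\<bar> \<le> Cu * (1 / real i powr s)" "\<bar>v (k - i)\<bar> \<le> Cv * (1 / real (k - i) powr s)"
      by (rule u v, fact i)+
    have "1 / real i powr s * (1 / real (k - i) powr s) = (1 / real i * (1 / real (k - i))) powr s"
      by (simp add: powr_divide powr_mult)
    also have "1 / real i * (1 / real (k - i)) = (1 / real i + 1 / real (k - i)) * (1 / real k)"
      using i by (simp add: field_simps of_nat_diff)
    also have "\<dots> powr s = (1 / real i + 1 / real (k - i)) powr s * ?K"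
      by (simp add: powr_mult powr_divide)
    also have "\<dots> \<le> 2 powr (s - 1) * ((1 / real i) powr s + (1 / real (k - i)) powr s) * ?K"
      using i assms by (intro mult_right_mono powr_sum_le) auto
    finally show "1 / real i powr s * (1 / real (k - i) powr s)
        \<le> 2 powr (s - 1) * (1 / real i powr s + 1 / real (k - i) powr s) * ?K"
      by (simp add: powr_divide)
  qed (use assms in auto)
  have tail: "(\<Sum>i = n + 1..k - n - 1. 1 / real i powr s) \<le> ?R"
  proof -
    \<comment> \<open>The middle block has \<open>k - 2 * n - 1\<close> terms and is empty when
      \<open>k = 2 * n + 1\<close>.\<close>
    have "(\<Sum>i = n + 1..k - n - 1. 1 / real i powr s) = (\<Sum>i<k - 2 * n - 1. 1 / real (Suc (i + n)) powr s)"
      using k by (intro sum.reindex_bij_witness[where i = "\<lambda>i. Suc (i + n)" and j = "\<lambda>i. i - Suc n"]) auto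
    then show ?thesis
      using sum_powr_tail_le assms by simp
  qed
  \<comment> \<open>The middle block is symmetric under \<open>i\<close> to \<open>k - i\<close>, so
    convexity produces the same tail twice; this factor 2 turns \<open>2 powr (s - 1)\<close> into
    \<open>2 powr s\<close>.\<close>
  have reflected: "(\<Sum>i = n + 1..k - n - 1. 1 / real (k - i) powr s) = (\<Sum>i = n + 1..k - n - 1. 1 / real i powr s)"
    by (rule sum.reindex_bij_witness[where i = "\<lambda>i. k - i" and j = "\<lambda>i. k - i"]) (use k in auto)
  have "\<bar>\<Sum>i = n + 1..k - n - 1. u i * v (k - i)\<bar>
      \<le> (\<Sum>i = n + 1..k - n - 1. Cu * Cv * (2 powr (s - 1) * (1 / real i powr s + 1 / real (k - i) powr s) * ?K))"
    by (rule order_trans[OF sum_abs], rule sum_mono, rule middle)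
  also have "\<dots> = Cu * Cv * (2 powr (s - 1) * (2 * (\<Sum>i = n + 1..k - n - 1. 1 / real i powr s)) * ?K)"
    by (simp only: sum_distrib_left[symmetric] sum_distrib_right[symmetric] sum.distrib reflected mult_2)
  also have "\<dots> \<le> Cu * Cv * (2 powr (s - 1) * (2 * ?R) * ?K)"
    using assms by (intro mult_left_mono mult_right_mono tail) auto
  also have "\<dots> = Cu * Cv * 2 powr s * ?R * ?K"
    by (simp add: powr_diff)
  finally have mid: "\<bar>\<Sum>i = n + 1..k - n - 1. u i * v (k - i)\<bar> \<le> Cu * Cv * 2 powr s * ?R * ?K" .
  have low: "\<bar>\<Sum>i = 1..n. u i * v (k - i)\<bar> \<le> (\<Sum>i = 1..n. Cv * \<bar>u i\<bar> * ?q i * ?K)"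
    by (rule order_trans[OF sum_abs], rule sum_mono, rule edge) (use assms in auto)
  have high: "\<bar>\<Sum>i = 1..n. v i * u (k - i)\<bar> \<le> (\<Sum>i = 1..n. Cu * \<bar>v i\<bar> * ?q i * ?K)"
    by (rule order_trans[OF sum_abs], rule sum_mono, rule edge) (use assms in auto)
  have "{1..k - 1} = {1..n} \<union> {n + 1..k - n - 1} \<union> {k - n..k - 1}"
    using k by auto
  then have "(\<Sum>i = 1..k - 1. u i * v (k - i))
      = (\<Sum>i = 1..n. u i * v (k - i)) + (\<Sum>i = n + 1..k - n - 1. u i * v (k - i))
        + (\<Sum>i = k - n..k - 1. u i * v (k - i))"
    using k by (simp only:) (subst sum.union_disjoint; (subst sum.union_disjoint)?; auto)
  \<comment> \<open>Reflection moves the upper end block to \<open>1..n\<close>, with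
    \<open>v\<close> now in the unrestricted position.\<close>
  also have "(\<Sum>i = k - n..k - 1. u i * v (k - i)) = (\<Sum>i = 1..n. v i * u (k - i))"
    by (rule sum.reindex_bij_witness[where i = "\<lambda>i. k - i" and j = "\<lambda>i. k - i"]) (use k in auto)
  finally have "\<bar>\<Sum>i = 1..k - 1. u i * v (k - i)\<bar>
      \<le> (\<Sum>i = 1..n. Cv * \<bar>u i\<bar> * ?q i * ?K) + Cu * Cv * 2 powr s * ?R * ?K + (\<Sum>i = 1..n. Cu * \<bar>v i\<bar> * ?q i * ?K)"
    using low mid high by linarith
  also have "\<dots> = ((\<Sum>i = 1..n. (Cu * \<bar>v i\<bar> + Cv * \<bar>u i\<bar>) * ?q i) + Cu * Cv * 2 powr s * ?R) * ?K"
    by (simp only: distrib_right sum.distrib sum_distrib_right add_ac)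
  finally show ?thesis .
qed

section \<open>Convergence, the product formula and the three coefficient estimates\<close>

theorem lemma5p1:
  fixes u v :: "nat \<Rightarrow> real" and n :: nat and s Cu Cv :: real
  assumes "n \<ge> 1" and "s > 1" and "Cu > 0" and "Cv > 0"
    and "\<And>i. i > n \<Longrightarrow> u i \<in> {- (Cu / real i powr s) .. Cu / real i powr s}"
    and "\<And>i. i > n \<Longrightarrow> v i \<in> {- (Cv / real i powr s) .. Cv / real i powr s}"
  shows
    "(\<forall>x. summable (\<lambda>i. u (Suc i) * sin (real (Suc i) * x))
        \<and> summable (\<lambda>i. v (Suc i) * sin (real (Suc i) * x)))
     \<and> (\<forall>k. summable (\<lambda>i. u (Suc i + k) * v (Suc i))
          \<and> summable (\<lambda>i. u (Suc i) * v (Suc i + k)))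
     \<and> (\<forall>x. summable (\<lambda>k. prod_coeff u v (Suc k) * cos (real (Suc k) * x))
          \<and> sine_series u x * sine_series v x
            = prod_coeff u v 0 + (\<Sum>k. prod_coeff u v (Suc k) * cos (real (Suc k) * x)))
     \<and> prod_coeff u v 0
         \<in> centered_interval (1 / 2 * (\<Sum>i = 1..n. u i * v i))
              (Cu * Cv / 2 * (real n powr (1 - 2 * s) / (2 * s - 1)))
     \<and> (\<forall>k. 1 \<le> k \<and> k \<le> 2 * n \<longrightarrow>
          prod_coeff u v k
            \<in> centered_interval
                (1 / 2 * (\<Sum>i = 1..n. u i * v (i + k))
                 + 1 / 2 * (\<Sum>i = 1..n. u (i + k) * v i)
                 - 1 / 2 * (\<Sum>i = 1..k - 1. u i * v (k - i)))
                (Cu * Cv * (real n powr (1 - 2 * s) / (2 * s - 1))))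
     \<and> (\<forall>k > 2 * n.
          prod_coeff u v k
            \<in> {- (tail_bound u v Cu Cv s n / real k powr s)
               .. tail_bound u v Cu Cv s n / real k powr s})"
proof -
  have u: "\<bar>u i\<bar> \<le> Cu * (1 / real i powr s)" and v: "\<bar>v i\<bar> \<le> Cv * (1 / real i powr s)" if "i > n" for i
    using assms(5,6)[OF that] by (simp_all add: abs_le_iff)
  have abs: "summable (\<lambda>i. \<bar>u (Suc i)\<bar>)" "summable (\<lambda>i. \<bar>v (Suc i)\<bar>)"
    by (rule powr_decay_tail(1)[OF _ _ _ u] powr_decay_tail(1)[OF _ _ _ v]; use assms(1-4) in simp)+
  have sine: "summable (\<lambda>i. u (Suc i) * sin (real (Suc i) * x))" "summable (\<lambda>i. v (Suc i) * sin (real (Suc i) * x))" for x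
    by (intro summable_rabs_cancel[OF abs_summable_sine_series] abs)+
  have shifted: "summable (\<lambda>i. u (Suc i + k) * v (Suc i))" "summable (\<lambda>i. u (Suc i) * v (Suc i + k))" for k
    using shifted_product_has_sum[OF abs, of k] shifted_product_has_sum[OF abs(2,1), of k]
    by (auto dest!: has_sum_imp_sums sums_summable simp: mult.commute)
  have product: "summable (\<lambda>k. prod_coeff u v (Suc k) * cos (real (Suc k) * x))"
    "sine_series u x * sine_series v x
      = prod_coeff u v 0 + (\<Sum>k. prod_coeff u v (Suc k) * cos (real (Suc k) * x))" for x
    using sine_series_product[OF abs, of x] by (auto simp only: sums_iff)
  let ?T = "real n powr (1 - 2 * s) / (2 * s - 1)"
  have tail: "\<bar>(\<Sum>i. u (Suc i + k) * v (Suc i)) - (\<Sum>i = 1..n. u (i + k) * v i)\<bar> \<le> Cu * Cv * ?T"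
    "\<bar>(\<Sum>i. u (Suc i) * v (Suc i + k)) - (\<Sum>i = 1..n. u i * v (i + k))\<bar> \<le> Cu * Cv * ?T" for k
    using shifted_product_tail[of n s Cu Cv u v k, OF _ _ _ _ u v]
      shifted_product_tail[of n s Cv Cu v u k, OF _ _ _ _ v u] assms(1-4)
    by (simp_all add: mult.commute)
  have zero: "prod_coeff u v 0 \<in> centered_interval (1 / 2 * (\<Sum>i = 1..n. u i * v i)) (Cu * Cv / 2 * ?T)"
  proof (rule mem_centered_interval)
    have "\<bar>prod_coeff u v 0 - 1 / 2 * (\<Sum>i = 1..n. u i * v i)\<bar>
        = 1 / 2 * \<bar>(\<Sum>i. u (Suc i) * v (Suc i)) - (\<Sum>i = 1..n. u i * v i)\<bar>"
      by (simp add: prod_coeff_def abs_if)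
    also have "\<dots> \<le> 1 / 2 * (Cu * Cv * ?T)"
      using tail(1)[of 0] by (intro mult_left_mono) auto
    finally show "\<bar>prod_coeff u v 0 - 1 / 2 * (\<Sum>i = 1..n. u i * v i)\<bar> \<le> Cu * Cv / 2 * ?T"
      by (simp only: mult_ac times_divide_eq_left times_divide_eq_right mult_1_left)
  qed
  have low: "prod_coeff u v k
      \<in> centered_interval
          (1 / 2 * (\<Sum>i = 1..n. u i * v (i + k)) + 1 / 2 * (\<Sum>i = 1..n. u (i + k) * v i)
            - 1 / 2 * (\<Sum>i = 1..k - 1. u i * v (k - i)))
          (Cu * Cv * ?T)" if "1 \<le> k" for k
  proof (rule mem_centered_interval)
    \<comment> \<open>The convolution sum cancels exactly, and each of the two truncated correlation
      sums contributes half of \<open>Cu * Cv * ?T\<close>.\<close>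
    show "\<bar>prod_coeff u v k
        - (1 / 2 * (\<Sum>i = 1..n. u i * v (i + k)) + 1 / 2 * (\<Sum>i = 1..n. u (i + k) * v i)
            - 1 / 2 * (\<Sum>i = 1..k - 1. u i * v (k - i)))\<bar> \<le> Cu * Cv * ?T"
      using that tail[of k] unfolding prod_coeff_def by simp
  qed
  have high: "\<bar>prod_coeff u v k\<bar> \<le> tail_bound u v Cu Cv s n / real k powr s" if k: "k > 2 * n" for k
  proof -
    let ?K = "1 / real k powr s"
    let ?R = "real n powr (1 - s) / (s - 1)"
    let ?q = "\<lambda>i. ((2 * real n + 1) / (2 * real n + 1 - real i)) powr s"
    have uv: "\<bar>\<Sum>i. u (Suc i + k) * v (Suc i)\<bar> \<le> ((\<Sum>i = 1..n. Cu * \<bar>v i\<bar>) + Cu * Cv * ?R) * ?K"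
      by (rule shifted_product_decay[OF _ _ _ _ _ u v]) (use assms(1-4) k in auto)
    have "\<bar>\<Sum>i. v (Suc i + k) * u (Suc i)\<bar> \<le> ((\<Sum>i = 1..n. Cv * \<bar>u i\<bar>) + Cv * Cu * ?R) * ?K"
      by (rule shifted_product_decay[OF _ _ _ _ _ v u]) (use assms(1-4) k in auto)
    then have vu: "\<bar>\<Sum>i. u (Suc i) * v (Suc i + k)\<bar> \<le> ((\<Sum>i = 1..n. Cv * \<bar>u i\<bar>) + Cu * Cv * ?R) * ?K"
      by (simp only: mult.commute[of "v _" "u _"] mult.commute[of Cv Cu])
    have conv: "\<bar>\<Sum>i = 1..k - 1. u i * v (k - i)\<bar>
      \<le> ((\<Sum>i = 1..n. (Cu * \<bar>v i\<bar> + Cv * \<bar>u i\<bar>) * ?q i) + Cu * Cv * 2 powr s * ?R) * ?K"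
      by (rule convolution_decay[OF _ _ _ _ k u v]) (use assms(1-4) in auto)
    \<comment> \<open>The constants of \<open>tail_bound\<close> arise here: the two correlation
      sums give the 2 and the convolution gives \<open>t = 2 powr s\<close>.\<close>
    have combine: "1 / 2 * ((A + c * R) * K + (B + c * R) * K + (Q + c * t * R) * K)
        = 1 / 2 * (A + B + Q + c * (2 + t) * R) * K" for A B Q R K c t :: real
      by (simp add: algebra_simps)
    have abs_half: "\<bar>1 / 2 * (x + y - z)\<bar> \<le> 1 / 2 * (X + Y + Z)"
      if "\<bar>x\<bar> \<le> X" "\<bar>y\<bar> \<le> Y" "\<bar>z\<bar> \<le> Z" for x y z X Y Z :: real
      using that by (simp add: abs_le_iff)
    have coeff: "prod_coeff u v k = 1 / 2 * ((\<Sum>i. u (Suc i + k) * v (Suc i)) + (\<Sum>i. u (Suc i) * v (Suc i + k))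
        - (\<Sum>i = 1..k - 1. u i * v (k - i)))"
      using k by (simp add: prod_coeff_def)
    \<comment> \<open>In the factor \<open>1 + ?q i\<close>, the 1 comes from the correlation sums
      and \<open>?q i\<close> from the ends of the convolution.\<close>
    have "(\<Sum>i = 1..n. Cu * \<bar>v i\<bar>) + (\<Sum>i = 1..n. Cv * \<bar>u i\<bar>)
        + (\<Sum>i = 1..n. (Cu * \<bar>v i\<bar> + Cv * \<bar>u i\<bar>) * ?q i)
        = (\<Sum>i = 1..n. (Cu * \<bar>v i\<bar> + Cv * \<bar>u i\<bar>) * (1 + ?q i))"
      by (simp only: distrib_left mult_1_right sum.distrib)
    then have bound: "tail_bound u v Cu Cv s n / real k powr s
        = 1 / 2 * ((\<Sum>i = 1..n. Cu * \<bar>v i\<bar>) + (\<Sum>i = 1..n. Cv * \<bar>u i\<bar>)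
            + (\<Sum>i = 1..n. (Cu * \<bar>v i\<bar> + Cv * \<bar>u i\<bar>) * ?q i) + Cu * Cv * (2 + 2 powr s) * ?R) * ?K"
      by (simp only: tail_bound_def times_divide_eq_right mult_1_right)
    show ?thesis
      unfolding coeff bound combine[symmetric] by (rule abs_half[OF uv vu conv])
  qed
  show ?thesis
  proof (intro conjI allI impI)
    fix k assume "k > 2 * n"
    then show "prod_coeff u v k
        \<in> {- (tail_bound u v Cu Cv s n / real k powr s) .. tail_bound u v Cu Cv s n / real k powr s}"
      using high[of k] by (simp add: abs_le_iff)
  qed (fact sine shifted product zero | rule low, simp)+
qed

end
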